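(* Let $G$ be a finite vertex-labeled graph with two or more connected components, and suppose that the chromatic quasisymmetric function $X_G(x;q)$ is symmetric. Then the chromatic quasisymmetric function of each connected component of $G$ is symmetric.
   Context: Let $G$ be a finite simple graph whose vertices are labeled by $[n]=\{1,\ldots,n\}$. A proper coloring is a map $\kappa:[n]\to\mathbb{N}=\{1,2,3,\ldots\}$ with $\kappa(u)\neq\kappa(v)$ for adjacent $u,v$. The number of ascents $\mathrm{asc}(\kappa)$ is the number of edges $\{u,v\}$ with $u<v$ and $\kappa(u)<\kappa(v)$. The chromatic quasisymmetric function (CQF) is $X_G(x;q)=\sum_{\kappa} q^{\mathrm{asc}(\kappa)}x_{\kappa(1)}\cdots x_{\kappa(n)}$, summed over all proper colorings $\kappa$ of $G$; it is a power series in $x_1,x_2,\ldots$ with coefficients in $\mathbb{Z}[q]$. It is symmetric if it is invariant under all permutations of the variables $x_1,x_2,\ldots$. A connected component is regarded as a labeled graph via the relative order of the labels of its vertices. *)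

theory Defs
  imports
    "HOL-Library.Poly_Mapping"
    "HOL-Library.FuncSet"
    "HOL-Computational_Algebra.Polynomial"
    "HOL-Combinatorics.Permutations"
begin

text \<open>
  Power series in \<open>x\<^sub>1, x\<^sub>2, \<dots>\<close> with coefficients in \<open>\<int>[q]\<close>, given by their coefficient function.
  A monomial is its finitely supported exponent function. The index type is \<^typ>\<open>nat\<close>, but
  only the positive indices are variables: colours are positive, so index \<open>0\<close> never occurs in a
  monomial of a chromatic quasisymmetric function, and variable permutations fix it.
\<close>
type_synonym monomial = "nat \<Rightarrow>\<^sub>0 nat"
type_synonym power_series = "monomial \<Rightarrow> int poly"

text \<open>
  Replacing each \<open>x\<^sub>i\<close> by \<open>x\<^bsub>\<pi> i\<^esub>\<close>: in the result, the monomial with exponents \<open>m\<close> arises from the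
  monomial whose exponent at \<open>i\<close> is \<open>m (\<pi> i)\<close>.
\<close>
definition permute_variables :: "(nat \<Rightarrow> nat) \<Rightarrow> power_series \<Rightarrow> power_series" where
  "permute_variables \<pi> F = (\<lambda>m. F (Poly_Mapping.map_key \<pi> m))"

definition symmetric_series :: "power_series \<Rightarrow> bool" where
  "symmetric_series F \<longleftrightarrow> (\<forall>\<pi>. \<pi> permutes {1..} \<longrightarrow> permute_variables \<pi> F = F)"

text \<open>
  A finite simple graph with vertex set \<open>{1..n}\<close> is given by \<open>n\<close> and its set of edges.
\<close>
definition labeled_graph :: "nat \<Rightarrow> nat set set \<Rightarrow> bool" where
  "labeled_graph n E \<longleftrightarrow> (\<forall>e\<in>E. e \<subseteq> {1..n} \<and> card e = 2)"

definition proper_colorings :: "nat \<Rightarrow> nat set set \<Rightarrow> (nat \<Rightarrow> nat) set" where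
  "proper_colorings n E =
     {\<kappa> \<in> {1..n} \<rightarrow>\<^sub>E {1..}. \<forall>u v. {u, v} \<in> E \<longrightarrow> \<kappa> u \<noteq> \<kappa> v}"

definition asc :: "nat set set \<Rightarrow> (nat \<Rightarrow> nat) \<Rightarrow> nat" where
  "asc E \<kappa> = card {e \<in> E. \<exists>u v. e = {u, v} \<and> u < v \<and> \<kappa> u < \<kappa> v}"

text \<open>The exponent function of \<open>x\<^bsub>\<kappa> 1\<^esub> \<cdots> x\<^bsub>\<kappa> n\<^esub>\<close>.\<close>
definition coloring_monomial :: "nat \<Rightarrow> (nat \<Rightarrow> nat) \<Rightarrow> monomial" where
  "coloring_monomial n \<kappa> = (\<Sum>v\<in>{1..n}. Poly_Mapping.single (\<kappa> v) 1)"

text \<open>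
  The infinite sum over all proper colorings, coefficient by coefficient; by
  \<open>finite_colorings_of_monomial\<close> below each coefficient is a finite sum.
\<close>
definition cqf :: "nat \<Rightarrow> nat set set \<Rightarrow> power_series" where
  "cqf n E = (\<lambda>m. \<Sum>\<kappa> | \<kappa> \<in> proper_colorings n E \<and> coloring_monomial n \<kappa> = m.
                    Polynomial.monom 1 (asc E \<kappa>))"

lemma finite_colorings_of_monomial:
  "finite {\<kappa>. \<kappa> \<in> proper_colorings n E \<and> coloring_monomial n \<kappa> = m}"
proof (rule finite_subset)
  show "finite ({1..n} \<rightarrow>\<^sub>E Poly_Mapping.keys m)"
    by (intro finite_PiE) auto
  have "\<kappa> v \<in> Poly_Mapping.keys (coloring_monomial n \<kappa>)" if "v \<in> {1..n}" for \<kappa> v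
  proof -
    have "Poly_Mapping.lookup (coloring_monomial n \<kappa>) (\<kappa> v)
        = (\<Sum>w\<in>{1..n}. Poly_Mapping.lookup (Poly_Mapping.single (\<kappa> w) 1) (\<kappa> v))"
      by (simp add: coloring_monomial_def lookup_sum)
    also have "\<dots> \<ge> Poly_Mapping.lookup (Poly_Mapping.single (\<kappa> v) (1::nat)) (\<kappa> v)"
      by (rule member_le_sum[OF that]) auto
    finally show ?thesis
      by (simp add: in_keys_iff)
  qed
  then show "{\<kappa>. \<kappa> \<in> proper_colorings n E \<and> coloring_monomial n \<kappa> = m}
      \<subseteq> {1..n} \<rightarrow>\<^sub>E Poly_Mapping.keys m"
    by (auto simp: proper_colorings_def PiE_iff extensional_def)
qed

text \<open>Vertex sets of the connected components: the classes of mutually reachable vertices.\<close>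
definition components :: "nat \<Rightarrow> nat set set \<Rightarrow> nat set set" where
  "components n E =
     {1..n} // {(u, v). u \<in> {1..n} \<and> v \<in> {1..n} \<and> (\<lambda>a b. {a, b} \<in> E)\<^sup>*\<^sup>* u v}"

text \<open>
  The subgraph induced on \<open>C\<close>, as a labeled graph on \<open>{1..card C}\<close>: each vertex of \<open>C\<close> is relabeled
  by its rank in \<open>C\<close>, the unique order isomorphism from \<open>C\<close> onto \<open>{1..card C}\<close>.
\<close>
definition relabel :: "nat set \<Rightarrow> nat \<Rightarrow> nat" where
  "relabel C v = card {u \<in> C. u \<le> v}"

definition component_edges :: "nat set set \<Rightarrow> nat set \<Rightarrow> nat set set" where
  "component_edges E C = (\<lambda>e. relabel C ` e) ` {e \<in> E. e \<subseteq> C}"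

end

theory Submission
  imports Defs "HOL-Computational_Algebra.Polynomial_Factorial"
begin

text \<open>
  Let \<open>F\<close> be the series of one component, \<open>H\<close> the series of the remaining vertices and \<open>S = F H\<close> the
  symmetric series of the whole graph. If a permutation \<open>\<sigma>\<close> acts on the variables, then
  \<open>\<sigma>F \<sigma>H = \<sigma>S = S\<close>, so every \<open>\<sigma>F\<close> is a divisor of the one series \<open>S\<close>. In a factorial ring \<open>S \<noteq> 0\<close> has only
  finitely many divisors up to units, whereas there are infinitely many \<open>\<sigma>\<close>; hence two of the \<open>\<sigma>F\<close>
  coincide.

  To make this precise with univariate polynomials only, keep the variables \<open>x\<^sub>1, \<dots>, x\<^sub>N\<close>, set the others
  to \<open>0\<close> and substitute \<open>x\<^sub>j + t\<close> for \<open>x\<^sub>j\<close>. This gives polynomials in \<open>t\<close> over the fraction field of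
  \<open>\<int>[q][x\<^sub>1, x\<^sub>2, \<dots>]\<close>. The coefficient of the top power of \<open>t\<close> in \<open>\<sigma>F\<close> is \<open>\<Sum>\<^sub>\<kappa> q\<^bsup>asc \<kappa>\<^esup>\<close>, which is nonzero
  and does not depend on \<open>\<sigma>\<close> (\<open>color_sum_shift\<close>), so associated images are equal. A polynomial of degree
  \<open>n\<close> has at most \<open>2\<^sup>n\<close> divisors with a given leading coefficient (\<open>card_divisors_with_lead_coeff\<close>), a
  bound independent of \<open>N\<close>. Apply the pigeonhole principle to the transpositions \<open>(i k)\<close> for more than
  \<open>2\<^sup>n\<close> large indices \<open>k\<close>, and put \<open>t = 0\<close>: for some \<open>k \<noteq> l\<close>, \<open>F\<close> takes the same value under \<open>(i k)\<close>
  and \<open>(i l)\<close>, that is, \<open>F\<close> is invariant under a 3-cycle of \<open>i, k, l\<close>. For a monomial \<open>m\<close> in which \<open>k\<close>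
  and \<open>l\<close> do not occur this says that the coefficient stays the same when \<open>x\<^sub>i\<close> is replaced by a
  variable \<open>x\<^sub>k\<close> that comes after all variables of \<open>m\<close> (\<open>cqf_key_raisable\<close>).

  Finally \<open>F\<close> is quasisymmetric: a coefficient depends only on the list of the exponents, read in the
  order of the variables (\<open>cqf_quasisymmetric\<close>). The previous step allows any entry of this list to be
  moved to its end, and such moves generate all rearrangements
  (\<open>symmetric_series_if_key_raisable\<close>).
\<close>

section \<open>Divisors of a polynomial over a field\<close>

text \<open>
  Split off a prime factor \<open>r\<close> of \<open>p\<close>: a divisor of \<open>p\<close> either is \<open>r\<close> times a divisor of \<open>p / r\<close> or is
  coprime to \<open>r\<close> and then divides \<open>p / r\<close> itself. So each factor at most doubles the count.
\<close>
lemma card_divisors_with_lead_coeff: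
  fixes p :: "'a::field poly"
  assumes "p \<noteq> 0" shows "finite {g. g dvd p \<and> lead_coeff g = c} \<and> card {g. g dvd p \<and> lead_coeff g = c} \<le> 2 ^ degree p"
  using assms
proof (induction "degree p" arbitrary: p c rule: less_induct)
  case less
  show ?case
  proof (cases "degree p = 0")
    case True
    have "g = [:c:]" if "g dvd p" "lead_coeff g = c" for g
    proof -
      have "degree g = 0" using that(1) True less.prems dvd_imp_degree_le[of g p] by simp
      then show ?thesis using that(2) by (auto elim!: degree_eq_zeroE)
    qed
    then have "{g. g dvd p \<and> lead_coeff g = c} \<subseteq> {[:c:]}" by auto
    then show ?thesis using True card_mono[of "{[:c:]}"] by (auto intro: finite_subset)
  next
    case False
    then have "\<not> is_unit p" using less.prems by (auto simp: is_unit_iff_degree)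
    \<comment> \<open>A nonunit divisor of least degree is irreducible.\<close>
    define r where "r = arg_min degree (\<lambda>r. r dvd p \<and> \<not> is_unit r)"
    have r: "r dvd p" "\<not> is_unit r" 
      using arg_min_natI[of "\<lambda>r. r dvd p \<and> \<not> is_unit r" p degree] \<open>\<not> is_unit p\<close> by (auto simp: r_def)
    have rmin: "degree r \<le> degree s" if "s dvd p" "\<not> is_unit s" for s
      using arg_min_nat_le[of "\<lambda>r. r dvd p \<and> \<not> is_unit r" s degree] that by (auto simp: r_def)
    have r0: "r \<noteq> 0" using r less.prems by auto
    have "irreducible r"
    proof (rule irreducibleI)
      fix a b assume ab: "r = a * b"
      show "is_unit a \<or> is_unit b"
      proof (rule ccontr)
        assume "\<not> ?thesis"
        then have "\<not> is_unit a" "\<not> is_unit b" by auto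
        then have "degree r \<le> degree a" "degree b > 0"
          using rmin[of a] r ab r0 by (auto simp: is_unit_iff_degree dest: dvd_mult_left)
        then show False using ab r0 by (simp add: degree_mult_eq)
      qed
    qed (use r r0 in auto)
    then have prime: "prime_elem r" by (rule field_poly_irreducible_imp_prime)
    obtain p' where p': "p = r * p'" using r by auto
    have p'0: "p' \<noteq> 0" using p' less.prems by auto
    have dr: "degree r > 0" using r r0 by (auto simp: is_unit_iff_degree)
    then have deg: "Suc (degree p') \<le> degree p" using p' p'0 r0 by (simp add: degree_mult_eq)
    let ?D = "\<lambda>c. {g. g dvd p' \<and> lead_coeff g = c}"
    have IH: "finite (?D c)" "card (?D c) \<le> 2 ^ degree p'" for c
      using less.hyps[of p' c] deg p'0 by auto
    have sub: "{g. g dvd p \<and> lead_coeff g = c} \<subseteq> (*) r ` ?D (c / lead_coeff r) \<union> ?D c"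
    proof
      fix g assume "g \<in> {g. g dvd p \<and> lead_coeff g = c}"
      then have g: "g dvd p" "lead_coeff g = c" by auto
      show "g \<in> (*) r ` ?D (c / lead_coeff r) \<union> ?D c"
      proof (cases "r dvd g")
        case True
        then obtain g' where g': "g = r * g'" by auto
        then have "g' \<in> ?D (c / lead_coeff r)"
          using g p' r0 by (auto simp: lead_coeff_mult)
        then show ?thesis using g' by auto
      next
        case False
        obtain h where h: "r * p' = g * h" using g p' by auto
        then have "r dvd h" using prime False prime_elem_dvd_multD[of r g h] by (metis dvd_triv_left)
        then obtain h' where "h = r * h'" by auto
        then have "p' = g * h'" using h r0 by auto
        then show ?thesis using g by auto
      qed
    qed
    have "card ((*) r ` ?D (c / lead_coeff r) \<union> ?D c) \<le> 2 ^ degree p' + 2 ^ degree p'"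
      using card_Un_le[of "(*) r ` ?D (c / lead_coeff r)" "?D c"] card_image_le[OF IH(1), of "(*) r" "c / lead_coeff r"]
        IH(2)[of "c / lead_coeff r"] IH(2)[of c] by linarith
    also have "\<dots> = 2 ^ Suc (degree p')" by simp
    also have "\<dots> \<le> 2 ^ degree p" using deg by (intro power_increasing) auto
    finally have "card ((*) r ` ?D (c / lead_coeff r) \<union> ?D c) \<le> 2 ^ degree p" .
    moreover have "finite ((*) r ` ?D (c / lead_coeff r) \<union> ?D c)" using IH by auto
    ultimately show ?thesis using sub by (meson card_mono finite_subset le_trans)
  qed
qed

section \<open>Generating sums of colorings with finitely many colors\<close>

definition colorings_upto :: "nat set \<Rightarrow> nat set set \<Rightarrow> nat \<Rightarrow> (nat \<Rightarrow> nat) set" where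
  "colorings_upto V E N = {\<kappa> \<in> V \<rightarrow>\<^sub>E {1..N}. \<forall>u v. {u, v} \<in> E \<longrightarrow> \<kappa> u \<noteq> \<kappa> v}"

text \<open>
  The series \<open>X\<^sub>G\<close> truncated to \<open>N\<close> variables and evaluated at \<open>y\<close>. The vertex set may be any set, so
  that components can be treated before their vertices are relabeled; the ring of values may be any
  commutative ring, so that the same sum can be read as a number, as a polynomial in the variables or
  as a polynomial in a shift parameter.
\<close>
definition color_sum ::
    "nat set \<Rightarrow> nat set set \<Rightarrow> nat \<Rightarrow> 'a :: comm_ring_1 \<Rightarrow> (nat \<Rightarrow> 'a) \<Rightarrow> 'a" where
  "color_sum V E N q y = (\<Sum>\<kappa> \<in> colorings_upto V E N. q ^ asc E \<kappa> * (\<Prod>v\<in>V. y (\<kappa> v)))"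

lemma finite_colorings_upto: "finite V \<Longrightarrow> finite (colorings_upto V E N)"
  unfolding colorings_upto_def by (rule finite_subset[of _ "V \<rightarrow>\<^sub>E {1..N}"]) (auto intro: finite_PiE)

lemma colorings_upto_in: "\<kappa> \<in> colorings_upto V E N \<Longrightarrow> v \<in> V \<Longrightarrow> \<kappa> v \<in> {1..N}"
  unfolding colorings_upto_def by auto

lemma color_sum_hom:
  assumes "h 0 = 0" "h 1 = 1" "\<And>a b. h (a + b) = h a + h b" "\<And>a b. h (a * b) = h a * h b"
  shows "h (color_sum V E N q y) = color_sum V E N (h q) (\<lambda>i. h (y i))"
proof -
  have sum: "h (sum f A) = (\<Sum>x\<in>A. h (f x))" for f and A :: "(nat \<Rightarrow> nat) set"
    by (induction A rule: infinite_finite_induct) (simp_all add: assms)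
  have prod: "h (prod f A) = (\<Prod>x\<in>A. h (f x))" for f and A :: "nat set"
    by (induction A rule: infinite_finite_induct) (simp_all add: assms)
  have power: "h (a ^ k) = h a ^ k" for a k
    by (induction k) (simp_all add: assms)
  show ?thesis
    by (simp add: color_sum_def sum prod power assms)
qed

lemma asc_cong:
  assumes "\<And>e v. e \<in> E \<Longrightarrow> v \<in> e \<Longrightarrow> \<kappa> v = \<kappa>' v"
  shows "asc E \<kappa> = asc E \<kappa>'"
proof -
  have "{e \<in> E. \<exists>u v. e = {u, v} \<and> u < v \<and> \<kappa> u < \<kappa> v} = {e \<in> E. \<exists>u v. e = {u, v} \<and> u < v \<and> \<kappa>' u < \<kappa>' v}"
    using assms by (intro Collect_cong) (metis insertCI)
  then show ?thesis by (simp add: asc_def)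
qed

text \<open>
  Colorings of a disjoint union are pairs of colorings of the two parts, and no edge joins the parts,
  so that ascents add up.
\<close>
lemma color_sum_disjoint_union:
  assumes fin: "finite V" "finite W" and disj: "V \<inter> W = {}"
    and E: "E = F \<union> G" and F: "\<And>e. e \<in> F \<Longrightarrow> e \<subseteq> V \<and> e \<noteq> {}" and G: "\<And>e. e \<in> G \<Longrightarrow> e \<subseteq> W \<and> e \<noteq> {}"
  shows "color_sum (V \<union> W) E N q y = color_sum V F N q y * color_sum W G N q y"
proof -
  define glue where "glue = (\<lambda>(\<kappa>, \<mu>) x. if x \<in> V then \<kappa> x else if x \<in> W then \<mu> x else undefined :: nat)"
  define wt where "wt V E \<kappa> = q ^ asc E \<kappa> * (\<Prod>v\<in>V. y (\<kappa> v))" for V E \<kappa>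
  have finE: "finite F" "finite G"
    using fin F G by (auto intro: finite_subset[of _ "Pow V"] finite_subset[of _ "Pow W"])
  have FG: "F \<inter> G = {}" using F G disj by blast
  have asc_union: "asc (F \<union> G) \<kappa> = asc F \<kappa> + asc G \<kappa>" for \<kappa>
    unfolding asc_def using finE FG by (subst card_Un_disjoint[symmetric]) (auto intro!: arg_cong[of _ _ card])
  have "color_sum V F N q y * color_sum W G N q y =
      (\<Sum>(\<kappa>, \<mu>) \<in> colorings_upto V F N \<times> colorings_upto W G N. wt V F \<kappa> * wt W G \<mu>)"
    unfolding color_sum_def wt_def by (simp add: sum_product sum.cartesian_product)
  also have "\<dots> = (\<Sum>\<kappa> \<in> colorings_upto (V \<union> W) E N. wt (V \<union> W) E \<kappa>)"
  proof (rule sum.reindex_bij_witness[where i = "\<lambda>\<kappa>. (restrict \<kappa> V, restrict \<kappa> W)" and j = glue])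
    fix p assume "p \<in> colorings_upto V F N \<times> colorings_upto W G N"
    then obtain \<kappa> \<mu> where p: "p = (\<kappa>, \<mu>)" "\<kappa> \<in> colorings_upto V F N" "\<mu> \<in> colorings_upto W G N" by auto
    have glueV: "glue p v = \<kappa> v" if "v \<in> V" for v using that by (simp add: glue_def p)
    have glueW: "glue p v = \<mu> v" if "v \<in> W" for v using that disj by (auto simp: glue_def p)
    show "(restrict (glue p) V, restrict (glue p) W) = p"
      using p(2,3) unfolding p(1) colorings_upto_def
      by (auto simp: glueV[unfolded p(1)] glueW[unfolded p(1)] fun_eq_iff PiE_def extensional_def restrict_def)
    show "glue p \<in> colorings_upto (V \<union> W) E N"
      unfolding colorings_upto_def
    proof (intro CollectI conjI allI impI)
      show "glue p \<in> V \<union> W \<rightarrow>\<^sub>E {1..N}"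
      proof (rule PiE_I)
        fix v assume "v \<in> V \<union> W"
        then show "glue p v \<in> {1..N}"
          using colorings_upto_in[OF p(2), of v] colorings_upto_in[OF p(3), of v] by (auto simp only: glueV glueW Un_iff)
      qed (simp add: glue_def p(1))
      fix u v assume "{u, v} \<in> E"
      then consider "{u, v} \<in> F" | "{u, v} \<in> G" using E by auto
      then show "glue p u \<noteq> glue p v"
      proof cases
        case 1
        then have "u \<in> V" "v \<in> V" using F by auto
        then show ?thesis using 1 p(2) by (simp add: glueV colorings_upto_def)
      next
        case 2
        then have "u \<in> W" "v \<in> W" using G by auto
        then show ?thesis using 2 p(3) by (simp add: glueW colorings_upto_def)
      qed
    qed
    have "asc F (glue p) = asc F \<kappa>"
      by (rule asc_cong) (use F glueV in blast)
    moreover have "asc G (glue p) = asc G \<mu>"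
      by (rule asc_cong) (use G glueW in blast)
    ultimately have "asc E (glue p) = asc F \<kappa> + asc G \<mu>"
      by (simp add: E asc_union)
    moreover have "(\<Prod>v\<in>V \<union> W. y (glue p v)) = (\<Prod>v\<in>V. y (\<kappa> v)) * (\<Prod>v\<in>W. y (\<mu> v))"
      using fin disj by (simp add: prod.union_disjoint glueV glueW cong: prod.cong)
    ultimately show "wt (V \<union> W) E (glue p) = (case p of (\<kappa>, \<mu>) \<Rightarrow> wt V F \<kappa> * wt W G \<mu>)"
      by (simp add: p wt_def power_add)
  next
    fix \<kappa> assume \<kappa>: "\<kappa> \<in> colorings_upto (V \<union> W) E N"
    show "glue (restrict \<kappa> V, restrict \<kappa> W) = \<kappa>"
      using \<kappa> by (auto simp: glue_def colorings_upto_def PiE_def extensional_def fun_eq_iff)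
    have "restrict \<kappa> V \<in> colorings_upto V F N" 
      using \<kappa> E F by (auto simp: colorings_upto_def restrict_PiE_iff dest: F)
    moreover have "restrict \<kappa> W \<in> colorings_upto W G N"
      using \<kappa> E G by (auto simp: colorings_upto_def restrict_PiE_iff dest: G)
    ultimately show "(restrict \<kappa> V, restrict \<kappa> W) \<in> colorings_upto V F N \<times> colorings_upto W G N" by simp
  qed
  finally show ?thesis by (simp add: color_sum_def wt_def)
qed

text \<open>
  Ascents compare the labels of the end points of an edge, so they survive an order-preserving
  change of labels.
\<close>
lemma color_sum_relabel:
  assumes bij: "bij_betw f V W" and mono: "strict_mono_on V f" and E: "\<And>e. e \<in> E \<Longrightarrow> e \<subseteq> V"
  shows "color_sum W ((`) f ` E) N q y = color_sum V E N q y"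
proof -
  define g where "g = inv_into V f"
  have fg: "f (g w) = w" "g w \<in> V" if "w \<in> W" for w
    using that bij unfolding g_def by (auto simp: bij_betw_def f_inv_into_f inv_into_into)
  have gf: "g (f v) = v" "f v \<in> W" if "v \<in> V" for v
    using that bij unfolding g_def by (auto simp: bij_betw_def)
  have f_less: "f u < f v \<longleftrightarrow> u < v" if "u \<in> V" "v \<in> V" for u v
    using mono that by (metis strict_mono_on_less)
  have img: "f ` {u, v} = {f u, f v}" for u v by simp
  have asc_eq: "asc E (restrict (\<kappa> \<circ> f) V) = asc ((`) f ` E) \<kappa>" for \<kappa>
  proof -
    have Collect_image: "{d \<in> h ` A. Q d} = h ` {a \<in> A. P a}" if "\<And>a. a \<in> A \<Longrightarrow> P a \<longleftrightarrow> Q (h a)"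
      for h :: "nat set \<Rightarrow> nat set" and A P Q
      using that by auto
    have "inj_on ((`) f) (Pow V)"
      using bij by (auto simp: bij_betw_def intro: inj_on_image_Pow)
    then have inj: "inj_on ((`) f) {e \<in> E. \<exists>u v. e = {u, v} \<and> u < v \<and> restrict (\<kappa> \<circ> f) V u < restrict (\<kappa> \<circ> f) V v}"
      by (rule inj_on_subset) (use E in auto)
    have "(\<exists>u v. e = {u, v} \<and> u < v \<and> restrict (\<kappa> \<circ> f) V u < restrict (\<kappa> \<circ> f) V v) \<longleftrightarrow>
          (\<exists>u v. f ` e = {u, v} \<and> u < v \<and> \<kappa> u < \<kappa> v)" if "e \<in> E" for e
    proof
      assume "\<exists>u v. e = {u, v} \<and> u < v \<and> restrict (\<kappa> \<circ> f) V u < restrict (\<kappa> \<circ> f) V v"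
      then obtain u v where uv: "e = {u, v}" "u < v" "restrict (\<kappa> \<circ> f) V u < restrict (\<kappa> \<circ> f) V v" by auto
      then have "u \<in> V" "v \<in> V" using E[OF that] by auto
      then show "\<exists>u v. f ` e = {u, v} \<and> u < v \<and> \<kappa> u < \<kappa> v"
        using uv f_less by (intro exI[of _ "f u"] exI[of _ "f v"]) auto
    next
      assume "\<exists>u v. f ` e = {u, v} \<and> u < v \<and> \<kappa> u < \<kappa> v"
      then obtain u v where uv: "f ` e = {u, v}" "u < v" "\<kappa> u < \<kappa> v" by auto
      then have mem: "u \<in> f ` e" "v \<in> f ` e" by auto
      then have uvW: "u \<in> W" "v \<in> W" using E[OF that] gf by auto
      have "g ` f ` e = (\<lambda>v. v) ` e" unfolding image_image using E[OF that] gf by (intro image_cong) auto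
      then have "e = g ` f ` e" by simp
      then have e: "e = {g u, g v}" using uv by simp
      moreover have "g u < g v" using f_less[of "g u" "g v"] fg uvW uv by auto
      ultimately show "\<exists>u v. e = {u, v} \<and> u < v \<and> restrict (\<kappa> \<circ> f) V u < restrict (\<kappa> \<circ> f) V v"
        using uv fg uvW by (intro exI[of _ "g u"] exI[of _ "g v"]) auto
    qed
    then have "{e \<in> (`) f ` E. \<exists>u v. e = {u, v} \<and> u < v \<and> \<kappa> u < \<kappa> v}
      = (`) f ` {e \<in> E. \<exists>u v. e = {u, v} \<and> u < v \<and> restrict (\<kappa> \<circ> f) V u < restrict (\<kappa> \<circ> f) V v}" by (rule Collect_image)
    then show ?thesis unfolding asc_def using inj by (simp add: card_image)
  qed
  show ?thesis
    unfolding color_sum_def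
  proof (rule sum.reindex_bij_witness[where j = "\<lambda>\<kappa>. restrict (\<kappa> \<circ> f) V" and i = "\<lambda>\<kappa>. restrict (\<kappa> \<circ> g) W"])
    fix \<kappa> assume \<kappa>: "\<kappa> \<in> colorings_upto W ((`) f ` E) N"
    show "restrict (restrict (\<kappa> \<circ> f) V \<circ> g) W = \<kappa>"
      using \<kappa> fg by (auto simp: colorings_upto_def PiE_def extensional_def fun_eq_iff)
    show "restrict (\<kappa> \<circ> f) V \<in> colorings_upto V E N"
      unfolding colorings_upto_def
    proof (intro CollectI conjI allI impI)
      show "restrict (\<kappa> \<circ> f) V \<in> V \<rightarrow>\<^sub>E {1..N}"
        using \<kappa> gf by (auto simp: colorings_upto_def)
      fix u v assume uv: "{u, v} \<in> E"
      then have "{f u, f v} \<in> (`) f ` E" using img[of u v] by (metis imageI)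
      then have "\<kappa> (f u) \<noteq> \<kappa> (f v)" using \<kappa> by (auto simp: colorings_upto_def)
      then show "restrict (\<kappa> \<circ> f) V u \<noteq> restrict (\<kappa> \<circ> f) V v" using E[OF uv] by auto
    qed
    have "(\<Prod>v\<in>V. y (restrict (\<kappa> \<circ> f) V v)) = (\<Prod>v\<in>W. y (\<kappa> v))"
      using prod.reindex_bij_betw[OF bij, of "\<lambda>w. y (\<kappa> w)"] by simp
    then show "q ^ asc E (restrict (\<kappa> \<circ> f) V) * (\<Prod>v\<in>V. y (restrict (\<kappa> \<circ> f) V v)) =
        q ^ asc ((`) f ` E) \<kappa> * (\<Prod>v\<in>W. y (\<kappa> v))" by (simp add: asc_eq)
  next
    fix \<kappa> assume \<kappa>: "\<kappa> \<in> colorings_upto V E N"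
    show "restrict (restrict (\<kappa> \<circ> g) W \<circ> f) V = \<kappa>"
      using \<kappa> gf by (auto simp: colorings_upto_def PiE_def extensional_def fun_eq_iff)
    show "restrict (\<kappa> \<circ> g) W \<in> colorings_upto W ((`) f ` E) N"
      unfolding colorings_upto_def
    proof (intro CollectI conjI allI impI)
      show "restrict (\<kappa> \<circ> g) W \<in> W \<rightarrow>\<^sub>E {1..N}"
        using \<kappa> fg by (auto simp: colorings_upto_def)
      fix u v assume "{u, v} \<in> (`) f ` E"
      then obtain e where e: "e \<in> E" "{u, v} = f ` e" by auto
      then have mem: "u \<in> f ` e" "v \<in> f ` e" by auto
      then have uvW: "u \<in> W" "v \<in> W" using E[OF e(1)] gf by auto
      have "g ` f ` e = (\<lambda>v. v) ` e" unfolding image_image using E[OF e(1)] gf by (intro image_cong) auto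
      then have "e = g ` f ` e" by simp
      then have "e = {g u, g v}" by (simp flip: e(2))
      then have "{g u, g v} \<in> E" using e(1) by simp
      then show "restrict (\<kappa> \<circ> g) W u \<noteq> restrict (\<kappa> \<circ> g) W v" using \<kappa> uvW by (auto simp: colorings_upto_def)
    qed
  qed
qed

lemma relabel_order_isomorphism:
  assumes "finite C"
  shows "strict_mono_on C (relabel C)" "bij_betw (relabel C) C {1..card C}"
proof -
  show mono: "strict_mono_on C (relabel C)"
  proof (rule strict_mono_onI)
    fix u v assume "u \<in> C" "v \<in> C" "u < v"
    then have "{w \<in> C. w \<le> u} \<subseteq> {w \<in> C. w \<le> v}" "v \<in> {w \<in> C. w \<le> v} - {w \<in> C. w \<le> u}" by auto
    then have "{w \<in> C. w \<le> u} \<subset> {w \<in> C. w \<le> v}" by blast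
    then show "relabel C u < relabel C v" 
      unfolding relabel_def using assms by (intro psubset_card_mono) auto
  qed
  have "relabel C ` C \<subseteq> {1..card C}"
  proof clarify
    fix v assume "v \<in> C"
    then have "card {u \<in> C. u \<le> v} > 0" using assms by (auto simp: card_gt_0_iff)
    moreover have "card {u \<in> C. u \<le> v} \<le> card C" using assms by (intro card_mono) auto
    ultimately show "relabel C v \<in> {1..card C}" by (simp add: relabel_def)
  qed
  moreover have inj: "inj_on (relabel C) C" using mono by (rule strict_mono_on_imp_inj_on)
  ultimately show "bij_betw (relabel C) C {1..card C}"
    unfolding bij_betw_def by (metis card_atLeastAtMost card_image card_subset_eq diff_Suc_1 finite_atLeastAtMost)
qed

text \<open>
  The cofactor is the sum of the subgraph induced on the vertices outside \<open>C\<close>.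
\<close>
lemma color_sum_component_dvd:
  assumes G: "labeled_graph n E" and C: "C \<in> components n E"
  shows "color_sum {1..card C} (component_edges E C) N q y dvd color_sum {1..n} E N q y"
proof -
  let ?R = "{(u, v). u \<in> {1..n} \<and> v \<in> {1..n} \<and> (\<lambda>a b. {a, b} \<in> E)\<^sup>*\<^sup>* u v}"
  from C obtain x where x: "x \<in> {1..n}" "C = ?R `` {x}"
    unfolding components_def by (auto elim: quotientE)
  have Cn: "C \<subseteq> {1..n}" using x by auto
  have fin: "finite C" using Cn finite_subset by blast
  let ?D = "{1..n} - C"
  have E2: "e \<subseteq> {1..n}" "card e = 2" if "e \<in> E" for e using G that by (auto simp: labeled_graph_def)
  have step: "v \<in> C" if "u \<in> C" "{u, v} \<in> E" for u v
    using that x E2[OF that(2)] by (auto intro: rtranclp.rtrancl_into_rtrancl)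
  have split: "e \<subseteq> C \<or> e \<subseteq> ?D" if eE: "e \<in> E" for e
  proof -
    obtain u v where e: "e = {u, v}" using E2[OF eE] by (auto simp: card_2_iff)
    then have "{u, v} \<in> E" "{v, u} \<in> E" using eE by (auto simp: insert_commute)
    then have "u \<in> C \<longleftrightarrow> v \<in> C" using step by blast
    then show ?thesis using E2[OF eE] e by auto
  qed
  let ?F = "{e \<in> E. e \<subseteq> C}" and ?G = "{e \<in> E. e \<subseteq> ?D}"
  have "color_sum (C \<union> ?D) E N q y = color_sum C ?F N q y * color_sum ?D ?G N q y"
  proof (rule color_sum_disjoint_union)
    show "E = ?F \<union> ?G" using split by auto
    show "e \<subseteq> C \<and> e \<noteq> {}" if "e \<in> ?F" for e using E2[of e] that by auto
    show "e \<subseteq> ?D \<and> e \<noteq> {}" if "e \<in> ?G" for e using E2[of e] that by auto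
  qed (use fin in auto)
  moreover have "C \<union> ?D = {1..n}" using Cn by auto
  moreover have "color_sum {1..card C} (component_edges E C) N q y = color_sum C ?F N q y"
    unfolding component_edges_def by (rule color_sum_relabel) (use relabel_order_isomorphism[OF fin] in auto)
  ultimately show ?thesis by simp
qed

section \<open>Coefficients of the chromatic quasisymmetric function\<close>

lemma lookup_coloring_monomial:
  "Poly_Mapping.lookup (coloring_monomial n \<kappa>) c = card {v \<in> {1..n}. \<kappa> v = c}"
  by (simp add: coloring_monomial_def lookup_sum lookup_single when_def sum.If_cases Int_def)

lemma keys_coloring_monomial: "Poly_Mapping.keys (coloring_monomial n \<kappa>) = \<kappa> ` {1..n}"
proof -
  have "c \<in> Poly_Mapping.keys (coloring_monomial n \<kappa>) \<longleftrightarrow> {v \<in> {1..n}. \<kappa> v = c} \<noteq> {}" for c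
    by (simp add: in_keys_iff lookup_coloring_monomial)
  then show ?thesis by (auto simp: set_eq_iff)
qed

lemma lookup_map_key_permutes:
  "\<sigma> permutes S \<Longrightarrow> Poly_Mapping.lookup (Poly_Mapping.map_key \<sigma> m) c = Poly_Mapping.lookup m (\<sigma> c)"
  by (simp add: map_key.rep_eq permutes_inj)

text \<open>
  Permuting the colors of \<open>\<kappa>\<close> permutes the variables of its monomial.
\<close>
lemma coloring_monomial_eq_iff:
  assumes "\<sigma> permutes S"
  shows "coloring_monomial n (\<sigma> \<circ> \<kappa>) = m \<longleftrightarrow> coloring_monomial n \<kappa> = Poly_Mapping.map_key \<sigma> m"
proof -
  have all_image: "(\<forall>c. R c) \<longleftrightarrow> (\<forall>c. R (\<sigma> c))" for R
    using permutes_surj[OF assms] by (metis surjD)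
  have "coloring_monomial n (\<sigma> \<circ> \<kappa>) = m \<longleftrightarrow>
      (\<forall>c. card {v \<in> {1..n}. \<sigma> (\<kappa> v) = c} = Poly_Mapping.lookup m c)"
    by (auto simp: poly_mapping_eq_iff fun_eq_iff lookup_coloring_monomial)
  also have "\<dots> \<longleftrightarrow> (\<forall>c. card {v \<in> {1..n}. \<sigma> (\<kappa> v) = \<sigma> c} = Poly_Mapping.lookup m (\<sigma> c))"
    by (rule all_image)
  also have "\<dots> \<longleftrightarrow> coloring_monomial n \<kappa> = Poly_Mapping.map_key \<sigma> m"
    using inj_eq[OF permutes_inj[OF assms]]
    by (simp add: poly_mapping_eq_iff fun_eq_iff lookup_coloring_monomial lookup_map_key_permutes[OF assms])
  finally show ?thesis .
qed

lemma colorings_of_monomial_upto: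
  assumes "Poly_Mapping.keys m \<subseteq> {1..N}"
  shows "{\<kappa> \<in> proper_colorings n E. coloring_monomial n \<kappa> = m}
    = {\<kappa> \<in> colorings_upto {1..n} E N. coloring_monomial n \<kappa> = m}"
proof -
  have "\<kappa> v \<in> {1..N}" if "coloring_monomial n \<kappa> = m" "v \<in> {1..n}" for \<kappa> v
    using assms keys_coloring_monomial[of n \<kappa>] that by blast
  then show ?thesis
    by (fastforce simp: proper_colorings_def colorings_upto_def PiE_iff)
qed

lemma keys_colorings_upto:
  "\<kappa> \<in> colorings_upto {1..n} E N \<Longrightarrow> Poly_Mapping.keys (coloring_monomial n \<kappa>) \<subseteq> {1..N}"
  using colorings_upto_in[of \<kappa> "{1..n}" E N] by (auto simp: keys_coloring_monomial)

lemma coeff_cqf: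
  assumes "Poly_Mapping.keys m \<subseteq> {1..N}"
  shows "poly.coeff (cqf n E m) a
    = int (card {\<kappa> \<in> colorings_upto {1..n} E N. coloring_monomial n \<kappa> = m \<and> asc E \<kappa> = a})"
proof -
  have "poly.coeff (cqf n E m) a
      = (\<Sum>\<kappa> \<in> {\<kappa> \<in> colorings_upto {1..n} E N. coloring_monomial n \<kappa> = m}. if asc E \<kappa> = a then 1 else 0)"
    by (simp add: cqf_def colorings_of_monomial_upto[OF assms] coeff_sum coeff_monom)
  also have "\<dots> = int (card {\<kappa> \<in> colorings_upto {1..n} E N. coloring_monomial n \<kappa> = m \<and> asc E \<kappa> = a})"
    by (subst sum.If_cases) (auto simp: finite_colorings_upto Int_def conj_assoc)
  finally show ?thesis .
qed

text \<open>
  The value of the term of \<open>\<kappa>\<close> depends only on its monomial and its number of ascents. Symmetry says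
  that the number of colorings with given monomial and given number of ascents is unchanged when the
  variables of the monomial are permuted.
\<close>
lemma color_sum_symmetric:
  assumes sym: "symmetric_series (cqf n E)" and \<sigma>: "\<sigma> permutes {1..N}"
  shows "color_sum {1..n} E N q (\<lambda>i. y (\<sigma> i)) = color_sum {1..n} E N q y"
proof -
  let ?A = "colorings_upto {1..n} E N"
  define k where "k \<kappa> = (coloring_monomial n \<kappa>, asc E \<kappa>)" for \<kappa>
  define W where "W = (\<lambda>(m, a). q ^ a * (\<Prod>c\<in>{1..N}. y c ^ Poly_Mapping.lookup m c))"
  define T where "T = (\<lambda>(m :: nat \<Rightarrow>\<^sub>0 nat, a :: nat). (Poly_Mapping.map_key (inv \<sigma>) m, a))"
  have fin: "finite ?A" by (simp add: finite_colorings_upto)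
  have \<sigma>': "inv \<sigma> permutes {1..N}" using \<sigma> by (rule permutes_inv)
  have prod: "(\<Prod>v\<in>{1..n}. z (\<kappa> v)) = (\<Prod>c\<in>{1..N}. z c ^ Poly_Mapping.lookup (coloring_monomial n \<kappa>) c)"
    if "\<kappa> \<in> ?A" for \<kappa> and z :: "nat \<Rightarrow> 'a"
  proof -
    have "(\<Prod>v\<in>{1..n}. z (\<kappa> v)) = (\<Prod>c\<in>{1..N}. \<Prod>v\<in>{v \<in> {1..n}. \<kappa> v = c}. z (\<kappa> v))"
      by (rule prod.group[symmetric]) (use colorings_upto_in[OF that] in auto)
    then show ?thesis by (simp add: lookup_coloring_monomial)
  qed
  have L: "q ^ asc E \<kappa> * (\<Prod>v\<in>{1..n}. y (\<kappa> v)) = W (k \<kappa>)" if "\<kappa> \<in> ?A" for \<kappa>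
    using prod[OF that, of y] by (simp add: W_def k_def)
  have R: "q ^ asc E \<kappa> * (\<Prod>v\<in>{1..n}. y (\<sigma> (\<kappa> v))) = W (T (k \<kappa>))" if "\<kappa> \<in> ?A" for \<kappa>
  proof -
    have "(\<Prod>c\<in>{1..N}. y (\<sigma> c) ^ Poly_Mapping.lookup (coloring_monomial n \<kappa>) c)
        = (\<Prod>c\<in>{1..N}. y c ^ Poly_Mapping.lookup (coloring_monomial n \<kappa>) (inv \<sigma> c))"
      using prod.permute[OF \<sigma>, of "\<lambda>c. y c ^ Poly_Mapping.lookup (coloring_monomial n \<kappa>) (inv \<sigma> c)"]
      by (simp add: comp_def permutes_inverses[OF \<sigma>])
    then show ?thesis
      using prod[OF that, of "\<lambda>i. y (\<sigma> i)"] by (simp add: W_def T_def k_def lookup_map_key_permutes[OF \<sigma>'])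
  qed
  \<comment> \<open>Hence it suffices that \<open>T\<close> permutes the multiset of all pairs of a monomial and an ascent number.\<close>
  have "image_mset (\<lambda>\<kappa>. T (k \<kappa>)) (mset_set ?A) = image_mset k (mset_set ?A)"
  proof (rule multiset_eqI)
    fix p :: "(nat \<Rightarrow>\<^sub>0 nat) \<times> nat"
    obtain m a where p: "p = (m, a)" by force
    have cnt: "count (image_mset f (mset_set ?A)) p = card {\<kappa> \<in> ?A. f \<kappa> = p}" for f
      using fin by (simp add: count_image_mset Int_def conj_commute)
    have inv: "Poly_Mapping.map_key (inv \<sigma>) l = m \<longleftrightarrow> l = Poly_Mapping.map_key \<sigma> m" for l
      unfolding poly_mapping_eq_iff fun_eq_iff lookup_map_key_permutes[OF \<sigma>] lookup_map_key_permutes[OF \<sigma>']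
      by (metis permutes_inverses[OF \<sigma>])
    have keys: "Poly_Mapping.keys (Poly_Mapping.map_key \<sigma> m) \<subseteq> {1..N} \<longleftrightarrow> Poly_Mapping.keys m \<subseteq> {1..N}"
    proof -
      have "Poly_Mapping.keys (Poly_Mapping.map_key \<sigma> m) = \<sigma> -` Poly_Mapping.keys m"
        by (auto simp: in_keys_iff lookup_map_key_permutes[OF \<sigma>])
      then show ?thesis
        by (metis permutes_vimage[OF \<sigma>] surj_image_vimage_eq[OF permutes_surj[OF \<sigma>]] permutes_image[OF \<sigma>] vimage_mono image_mono)
    qed
    have "card {\<kappa> \<in> ?A. k \<kappa> = (Poly_Mapping.map_key \<sigma> m, a)} = card {\<kappa> \<in> ?A. k \<kappa> = (m, a)}"
    proof (cases "Poly_Mapping.keys m \<subseteq> {1..N}")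
      case True
      have "\<sigma> permutes {1..}" using \<sigma> by (rule permutes_subset) auto
      then have "cqf n E (Poly_Mapping.map_key \<sigma> m) = cqf n E m"
        using sym by (simp add: symmetric_series_def permute_variables_def fun_eq_iff)
      then have "int (card {\<kappa> \<in> ?A. k \<kappa> = (Poly_Mapping.map_key \<sigma> m, a)}) = int (card {\<kappa> \<in> ?A. k \<kappa> = (m, a)})"
        using coeff_cqf[of m N n E a] coeff_cqf[of "Poly_Mapping.map_key \<sigma> m" N n E a] True keys by (simp add: k_def)
      then show ?thesis by simp
    next
      case False
      have "k \<kappa> \<noteq> (Poly_Mapping.map_key \<sigma> m, a) \<and> k \<kappa> \<noteq> (m, a)" if "\<kappa> \<in> ?A" for \<kappa>
        using keys_colorings_upto[OF that] False keys by (metis fst_conv k_def)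
      then have "{\<kappa> \<in> ?A. k \<kappa> = (Poly_Mapping.map_key \<sigma> m, a)} = {}" "{\<kappa> \<in> ?A. k \<kappa> = (m, a)} = {}"
        by auto
      then show ?thesis by (simp only:)
    qed
    moreover have "T (k \<kappa>) = (m, a) \<longleftrightarrow> k \<kappa> = (Poly_Mapping.map_key \<sigma> m, a)" for \<kappa>
      using inv by (simp add: T_def k_def)
    ultimately show "count (image_mset (\<lambda>\<kappa>. T (k \<kappa>)) (mset_set ?A)) p = count (image_mset k (mset_set ?A)) p"
      unfolding cnt unfolding p by simp
  qed
  then have "sum_mset (image_mset W (image_mset (\<lambda>\<kappa>. T (k \<kappa>)) (mset_set ?A))) = sum_mset (image_mset W (image_mset k (mset_set ?A)))"
    by (simp only:)
  then have "(\<Sum>\<kappa>\<in>?A. W (T (k \<kappa>))) = (\<Sum>\<kappa>\<in>?A. W (k \<kappa>))"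
    by (simp add: sum_unfold_sum_mset image_mset.compositionality comp_def)
  then show ?thesis unfolding color_sum_def using L R by (simp cong: sum.cong)
qed

text \<open>
  Evaluated at the variables themselves, the sum is the truncated series as an actual polynomial over
  \<open>\<int>[q]\<close>, from which the coefficients can be recovered.
\<close>
lemma lookup_color_sum_variables:
  fixes E :: "nat set set"
  assumes \<sigma>: "\<sigma> permutes {1..N}" and m: "Poly_Mapping.keys m \<subseteq> {1..N}"
  shows "Poly_Mapping.lookup (color_sum {1..n} E N (Poly_Mapping.single 0 [:0, 1:])
      (\<lambda>i. Poly_Mapping.single (Poly_Mapping.single (\<sigma> i) 1) 1)) m
    = cqf n E (Poly_Mapping.map_key \<sigma> m)"
proof -
  let ?A = "colorings_upto {1..n} E N"
  have pow: "Poly_Mapping.single (0 :: monomial) [:0, 1 :: int:] ^ a = Poly_Mapping.single 0 (Polynomial.monom 1 a)" for a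
    by (induction a) (simp_all add: mult_single monom_Suc one_pCons flip: single_one)
  have prod: "(\<Prod>v\<in>A. Poly_Mapping.single (Poly_Mapping.single (f v) 1) (1 :: int poly))
      = Poly_Mapping.single (\<Sum>v\<in>A. Poly_Mapping.single (f v) (1 :: nat)) 1" for A :: "nat set" and f :: "nat \<Rightarrow> nat"
    by (induction A rule: infinite_finite_induct) (simp_all add: mult_single)
  have keys: "Poly_Mapping.keys (Poly_Mapping.map_key \<sigma> m) \<subseteq> {1..N}"
  proof
    fix c assume "c \<in> Poly_Mapping.keys (Poly_Mapping.map_key \<sigma> m)"
    then have "\<sigma> c \<in> Poly_Mapping.keys m" by (simp add: in_keys_iff lookup_map_key_permutes[OF \<sigma>])
    then have "\<sigma> c \<in> {1..N}" using m by blast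
    then show "c \<in> {1..N}" using permutes_in_image[OF \<sigma>] by blast
  qed
  have "Poly_Mapping.lookup (color_sum {1..n} E N (Poly_Mapping.single 0 [:0, 1:])
      (\<lambda>i. Poly_Mapping.single (Poly_Mapping.single (\<sigma> i) 1) 1)) m
     = (\<Sum>\<kappa>\<in>?A. if coloring_monomial n (\<sigma> \<circ> \<kappa>) = m then Polynomial.monom (1 :: int) (asc E \<kappa>) else 0)"
    unfolding color_sum_def pow prod
    by (simp add: lookup_sum mult_single lookup_single when_def coloring_monomial_def)
  also have "\<dots> = (\<Sum>\<kappa>\<in>{\<kappa> \<in> ?A. coloring_monomial n \<kappa> = Poly_Mapping.map_key \<sigma> m}. Polynomial.monom 1 (asc E \<kappa>))"
    by (simp add: coloring_monomial_eq_iff[OF \<sigma>] sum.inter_filter finite_colorings_upto)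
  also have "\<dots> = cqf n E (Poly_Mapping.map_key \<sigma> m)"
    by (simp add: cqf_def colorings_of_monomial_upto[OF keys])
  finally show ?thesis .
qed


section \<open>Quasisymmetry\<close>

lemma cqf_zero_key:
  assumes "0 \<in> Poly_Mapping.keys m" shows "cqf n E m = 0"
proof -
  have "{\<kappa>. \<kappa> \<in> proper_colorings n E \<and> coloring_monomial n \<kappa> = m} = {}"
  proof -
    have False if \<kappa>: "\<kappa> \<in> proper_colorings n E" "coloring_monomial n \<kappa> = m" for \<kappa>
    proof -
      obtain v where v: "v \<in> {1..n}" "\<kappa> v = 0" using assms keys_coloring_monomial[of n \<kappa>] \<kappa>(2) by force
      have "\<kappa> v \<in> {1..}" using \<kappa>(1) v(1) unfolding proper_colorings_def by (blast dest: PiE_mem)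
      then show False using v(2) by simp
    qed
    then show ?thesis by blast
  qed
  then show ?thesis by (simp only: cqf_def sum.empty)
qed

text \<open>
  Replacing the colors of a coloring through an order-preserving \<open>f\<close> changes neither properness nor
  the set of ascents.
\<close>
lemma recolor:
  assumes E: "\<And>e. e \<in> E \<Longrightarrow> e \<subseteq> {1..n}"
    and f: "strict_mono_on (Poly_Mapping.keys m) f" "f ` Poly_Mapping.keys m = Poly_Mapping.keys m'"
    and lookup: "\<And>i. i \<in> Poly_Mapping.keys m \<Longrightarrow> Poly_Mapping.lookup m' (f i) = Poly_Mapping.lookup m i"
    and pos: "0 \<notin> Poly_Mapping.keys m'"
    and \<kappa>: "\<kappa> \<in> proper_colorings n E" "coloring_monomial n \<kappa> = m"
  shows "restrict (f \<circ> \<kappa>) {1..n} \<in> proper_colorings n E"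
    and "coloring_monomial n (restrict (f \<circ> \<kappa>) {1..n}) = m'"
    and "asc E (restrict (f \<circ> \<kappa>) {1..n}) = asc E \<kappa>"
proof -
  let ?\<mu> = "restrict (f \<circ> \<kappa>) {1..n}"
  have mem: "\<kappa> v \<in> Poly_Mapping.keys m" if "v \<in> {1..n}" for v
    using that \<kappa>(2) keys_coloring_monomial[of n \<kappa>] by auto
  have inj: "f i = f j \<longleftrightarrow> i = j" if "i \<in> Poly_Mapping.keys m" "j \<in> Poly_Mapping.keys m" for i j
    using strict_mono_on_imp_inj_on[OF f(1)] that by (auto dest: inj_onD)
  have less: "f i < f j \<longleftrightarrow> i < j" if "i \<in> Poly_Mapping.keys m" "j \<in> Poly_Mapping.keys m" for i j
    using f(1) that by (metis strict_mono_on_less)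
  show "?\<mu> \<in> proper_colorings n E"
    unfolding proper_colorings_def
  proof (intro CollectI conjI allI impI)
    have "f (\<kappa> v) \<ge> 1" if "v \<in> {1..n}" for v
      using mem[OF that] f(2) pos by (metis One_nat_def Suc_leI imageI neq0_conv)
    then show "?\<mu> \<in> {1..n} \<rightarrow>\<^sub>E {1..}" by auto
    fix u v assume uv: "{u, v} \<in> E"
    then have "u \<in> {1..n}" "v \<in> {1..n}" using E[OF uv] by auto
    then show "?\<mu> u \<noteq> ?\<mu> v" using uv \<kappa>(1) inj[OF mem mem] by (auto simp: proper_colorings_def)
  qed
  show "coloring_monomial n ?\<mu> = m'"
  proof (rule poly_mapping_eqI)
    fix c
    show "Poly_Mapping.lookup (coloring_monomial n ?\<mu>) c = Poly_Mapping.lookup m' c"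
    proof (cases "c \<in> Poly_Mapping.keys m'")
      case True
      then obtain i where i: "i \<in> Poly_Mapping.keys m" "c = f i" using f(2) by auto
      have "{v \<in> {1..n}. ?\<mu> v = c} = {v \<in> {1..n}. \<kappa> v = i}" using i inj[OF mem] by auto
      then show ?thesis
        using lookup[OF i(1)] i(2) lookup_coloring_monomial[of n \<kappa> i] \<kappa>(2) by (simp add: lookup_coloring_monomial)
    next
      case False
      then have "{v \<in> {1..n}. ?\<mu> v = c} = {}" using mem f(2) by auto
      then show ?thesis using False by (simp add: lookup_coloring_monomial in_keys_iff)
    qed
  qed
  have "?\<mu> u < ?\<mu> v \<longleftrightarrow> \<kappa> u < \<kappa> v" if "{u, v} \<in> E" for u v
  proof -
    have "u \<in> {1..n}" "v \<in> {1..n}" using E[OF that] by auto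
    then show ?thesis using less[OF mem mem] by simp
  qed
  then have "{e \<in> E. \<exists>u v. e = {u, v} \<and> u < v \<and> ?\<mu> u < ?\<mu> v} = {e \<in> E. \<exists>u v. e = {u, v} \<and> u < v \<and> \<kappa> u < \<kappa> v}"
    by (intro Collect_cong) metis
  then show "asc E ?\<mu> = asc E \<kappa>" by (simp add: asc_def)
qed

definition exponents :: "monomial \<Rightarrow> nat list" where
  "exponents m = map (Poly_Mapping.lookup m) (sorted_list_of_set (Poly_Mapping.keys m))"

lemma cqf_quasisymmetric:
  assumes E: "\<And>e. e \<in> E \<Longrightarrow> e \<subseteq> {1..n}"
    and pos: "0 \<notin> Poly_Mapping.keys m" "0 \<notin> Poly_Mapping.keys m'"
    and exps: "exponents m = exponents m'"
  shows "cqf n E m = cqf n E m'"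
proof -
  \<comment> \<open>Match the \<open>a\<close>-th smallest variable of one monomial with the \<open>a\<close>-th smallest of the other.\<close>
  have transfer: "\<exists>f. strict_mono_on (Poly_Mapping.keys l) f \<and> f ` Poly_Mapping.keys l = Poly_Mapping.keys l'
      \<and> (\<forall>i \<in> Poly_Mapping.keys l. Poly_Mapping.lookup l' (f i) = Poly_Mapping.lookup l i)"
    if "exponents l = exponents l'" for l l'
  proof -
    let ?xs = "sorted_list_of_set (Poly_Mapping.keys l)" and ?ys = "sorted_list_of_set (Poly_Mapping.keys l')"
    define f where "f i = the (map_of (zip ?xs ?ys) i)" for i
    have len: "length ?xs = length ?ys" using that by (metis exponents_def length_map)
    have f: "f (?xs ! a) = ?ys ! a" if "a < length ?xs" for a
      using that len by (simp add: f_def map_of_zip_nth)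
    have "f i < f j" if ij: "i \<in> set ?xs" "j \<in> set ?xs" "i < j" for i j
    proof -
      obtain a b where ab: "a < length ?xs" "b < length ?xs" "i = ?xs ! a" "j = ?xs ! b"
        using ij by (metis in_set_conv_nth)
      have "a < b"
        using ab ij(3) sorted_nth_mono[OF sorted_sorted_list_of_set, of b a] by (metis not_less)
      then have "?ys ! a < ?ys ! b"
        using ab len by (intro sorted_wrt_nth_less[OF strict_sorted_list_of_set]) auto
      then show ?thesis using f ab by simp
    qed
    then have "strict_mono_on (Poly_Mapping.keys l) f" by (auto intro: strict_mono_onI)
    moreover have "f ` set ?xs = set ?ys"
    proof -
      have "map f ?xs = ?ys" using f len by (intro nth_equalityI) auto
      then show ?thesis by (metis set_map)
    qed
    moreover have "Poly_Mapping.lookup l' (f i) = Poly_Mapping.lookup l i" if i: "i \<in> set ?xs" for i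
    proof -
      obtain a where a: "a < length ?xs" "i = ?xs ! a" using i by (metis in_set_conv_nth)
      have "exponents l ! a = exponents l' ! a" using \<open>exponents l = exponents l'\<close> by simp
      then show ?thesis using a len f by (simp add: exponents_def)
    qed
    ultimately show ?thesis by auto
  qed
  from transfer[OF exps] obtain f where f: "strict_mono_on (Poly_Mapping.keys m) f"
      "f ` Poly_Mapping.keys m = Poly_Mapping.keys m'"
      "\<And>i. i \<in> Poly_Mapping.keys m \<Longrightarrow> Poly_Mapping.lookup m' (f i) = Poly_Mapping.lookup m i"
    by blast
  define g where "g = inv_into (Poly_Mapping.keys m) f"
  have inj: "inj_on f (Poly_Mapping.keys m)" using f(1) by (rule strict_mono_on_imp_inj_on)
  have gf: "g (f i) = i" if "i \<in> Poly_Mapping.keys m" for i using that inj by (simp add: g_def)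
  have fg: "f (g i) = i" "g i \<in> Poly_Mapping.keys m" if "i \<in> Poly_Mapping.keys m'" for i
    using that f(2) unfolding g_def by (auto simp: f_inv_into_f inv_into_into)
  have g: "strict_mono_on (Poly_Mapping.keys m') g" "g ` Poly_Mapping.keys m' = Poly_Mapping.keys m"
      "\<And>i. i \<in> Poly_Mapping.keys m' \<Longrightarrow> Poly_Mapping.lookup m (g i) = Poly_Mapping.lookup m' i"
  proof -
    show "strict_mono_on (Poly_Mapping.keys m') g"
      by (rule strict_mono_onI) (metis f(1) fg strict_mono_on_less)
    show "g ` Poly_Mapping.keys m' = Poly_Mapping.keys m"
      using gf fg f(2) by (auto simp: image_iff) (metis imageI)
    show "Poly_Mapping.lookup m (g i) = Poly_Mapping.lookup m' i" if "i \<in> Poly_Mapping.keys m'" for i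
      using f(3)[of "g i"] fg[OF that] by simp
  qed
  have mem: "\<kappa> v \<in> Poly_Mapping.keys l" if "coloring_monomial n \<kappa> = l" "v \<in> {1..n}" for \<kappa> v l
    using that keys_coloring_monomial[of n \<kappa>] by auto
  show ?thesis
    unfolding cqf_def
  proof (rule sum.reindex_bij_witness[where j = "\<lambda>\<kappa>. restrict (f \<circ> \<kappa>) {1..n}" and i = "\<lambda>\<kappa>. restrict (g \<circ> \<kappa>) {1..n}"])
    fix \<kappa> assume "\<kappa> \<in> {\<kappa> \<in> proper_colorings n E. coloring_monomial n \<kappa> = m}"
    then have \<kappa>: "\<kappa> \<in> proper_colorings n E" "coloring_monomial n \<kappa> = m" by auto
    note r = recolor[OF E f pos(2) \<kappa>]
    show "restrict (g \<circ> restrict (f \<circ> \<kappa>) {1..n}) {1..n} = \<kappa>"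
      using \<kappa>(1) gf mem[OF \<kappa>(2)] by (auto simp: proper_colorings_def PiE_def extensional_def fun_eq_iff)
    show "restrict (f \<circ> \<kappa>) {1..n} \<in> {\<kappa> \<in> proper_colorings n E. coloring_monomial n \<kappa> = m'}"
      using r by simp
    show "Polynomial.monom 1 (asc E (restrict (f \<circ> \<kappa>) {1..n})) = Polynomial.monom 1 (asc E \<kappa>)"
      using r by simp
  next
    fix \<kappa> assume "\<kappa> \<in> {\<kappa> \<in> proper_colorings n E. coloring_monomial n \<kappa> = m'}"
    then have \<kappa>: "\<kappa> \<in> proper_colorings n E" "coloring_monomial n \<kappa> = m'" by auto
    note r = recolor[OF E g pos(1) \<kappa>]
    show "restrict (f \<circ> restrict (g \<circ> \<kappa>) {1..n}) {1..n} = \<kappa>"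
      using \<kappa>(1) fg mem[OF \<kappa>(2)] by (auto simp: proper_colorings_def PiE_def extensional_def fun_eq_iff)
    show "restrict (g \<circ> \<kappa>) {1..n} \<in> {\<kappa> \<in> proper_colorings n E. coloring_monomial n \<kappa> = m}"
      using r by simp
  qed
qed

section \<open>A criterion for symmetry\<close>

text \<open>
  Replacing a variable by one that is larger than all others moves its exponent to the end of the list.
\<close>
lemma exponents_raise_key:
  assumes exps: "exponents m = xs @ a # ys"
  obtains i where "i \<in> Poly_Mapping.keys m"
    "\<And>k. \<forall>j \<in> Poly_Mapping.keys m. j < k \<Longrightarrow>
      exponents (Poly_Mapping.map_key (transpose i k) m) = xs @ ys @ [a]"
proof -
  let ?s = "sorted_list_of_set (Poly_Mapping.keys m)"
  obtain us i vs where s: "?s = us @ i # vs"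
    and map: "xs = map (Poly_Mapping.lookup m) us" "a = Poly_Mapping.lookup m i" "ys = map (Poly_Mapping.lookup m) vs"
    using exps unfolding exponents_def by (fastforce simp: map_eq_append_conv map_eq_Cons_conv)
  have set: "Poly_Mapping.keys m = insert i (set us \<union> set vs)"
    using arg_cong[OF s, of set] by auto
  have dist: "distinct (us @ i # vs)" using s by (metis distinct_sorted_list_of_set)
  have sorted: "sorted (us @ i # vs)" using s by (metis sorted_sorted_list_of_set)
  show ?thesis
  proof (rule that[of i])
    show "i \<in> Poly_Mapping.keys m" using set by simp
    fix k assume k: "\<forall>j \<in> Poly_Mapping.keys m. j < k"
    let ?m = "Poly_Mapping.map_key (transpose i k) m"
    have kk: "k \<notin> Poly_Mapping.keys m" using k by auto
    then have ki: "k \<noteq> i" using set by auto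
    have look: "Poly_Mapping.lookup ?m j = Poly_Mapping.lookup m (transpose i k j)" for j
      by (simp add: map_key.rep_eq)
    have "Poly_Mapping.keys ?m = insert k (set us \<union> set vs)"
    proof (rule set_eqI)
      fix j
      have "transpose i k j \<in> insert i (set us \<union> set vs) \<longleftrightarrow> j \<in> insert k (set us \<union> set vs)"
        using dist kk ki unfolding set by (auto simp: transpose_def)
      moreover have "j \<in> Poly_Mapping.keys ?m \<longleftrightarrow> transpose i k j \<in> Poly_Mapping.keys m"
        by (simp add: in_keys_iff look)
      ultimately show "j \<in> Poly_Mapping.keys ?m \<longleftrightarrow> j \<in> insert k (set us \<union> set vs)"
        by (simp add: set)
    qed
    then have "Poly_Mapping.keys ?m = set (us @ vs @ [k])" by auto
    moreover have "sorted (us @ vs @ [k])" "distinct (us @ vs @ [k])"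
      using sorted dist k kk unfolding set by (auto simp: sorted_append intro: less_imp_le)
    ultimately have "sorted_list_of_set (Poly_Mapping.keys ?m) = us @ vs @ [k]"
      by (metis sorted_list_of_set.idem_if_sorted_distinct)
    moreover have "Poly_Mapping.lookup ?m j = Poly_Mapping.lookup m j" if "j \<in> set us \<union> set vs" for j
      using that dist kk set unfolding look by (auto simp: transpose_def)
    moreover have "Poly_Mapping.lookup ?m k = Poly_Mapping.lookup m i" by (simp add: look)
    ultimately show "exponents ?m = xs @ ys @ [a]" by (simp add: exponents_def map)
  qed
qed

text \<open>
  The hypothesis \<open>raise\<close> moves one entry of the exponent list to the end. To rearrange a list into
  \<open>ys\<close>, move the entries of \<open>ys\<close> to the end one after the other, in the order in which \<open>ys\<close> lists them.
\<close>
lemma symmetric_series_if_key_raisable: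
  assumes zero: "\<And>m. 0 \<in> Poly_Mapping.keys m \<Longrightarrow> F m = 0"
    and quasi: "\<And>m m'. 0 \<notin> Poly_Mapping.keys m \<Longrightarrow> 0 \<notin> Poly_Mapping.keys m' \<Longrightarrow> exponents m = exponents m' \<Longrightarrow> F m = F m'"
    and raise: "\<And>m i. 0 \<notin> Poly_Mapping.keys m \<Longrightarrow> i \<in> Poly_Mapping.keys m \<Longrightarrow>
      \<exists>k. (\<forall>j \<in> Poly_Mapping.keys m. j < k) \<and> F (Poly_Mapping.map_key (transpose i k) m) = F m"
  shows "symmetric_series F"
proof -
  have to_end: "\<exists>m'. 0 \<notin> Poly_Mapping.keys m' \<and> exponents m' = xs @ ys @ [a] \<and> F m' = F m"
    if m: "0 \<notin> Poly_Mapping.keys m" "exponents m = xs @ a # ys" for m xs a ys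
  proof -
    obtain i where i: "i \<in> Poly_Mapping.keys m"
      "\<And>k. \<forall>j \<in> Poly_Mapping.keys m. j < k \<Longrightarrow> exponents (Poly_Mapping.map_key (transpose i k) m) = xs @ ys @ [a]"
      using exponents_raise_key[OF m(2)] by blast
    obtain k where k: "\<forall>j \<in> Poly_Mapping.keys m. j < k" "F (Poly_Mapping.map_key (transpose i k) m) = F m"
      using raise[OF m(1) i(1)] by blast
    have "i \<noteq> 0" using i(1) m(1) by metis
    moreover have "i < k" using i(1) k(1) by blast
    ultimately have "transpose i k 0 = 0" by (simp add: transpose_def)
    then have "0 \<notin> Poly_Mapping.keys (Poly_Mapping.map_key (transpose i k) m)"
      using m(1) by (simp add: in_keys_iff map_key.rep_eq)
    then show ?thesis using k i(2)[OF k(1)] by blast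
  qed
  \<comment> \<open>Here \<open>zs\<close> collects the entries that have been moved already.\<close>
  have rearrange: "\<exists>m'. 0 \<notin> Poly_Mapping.keys m' \<and> exponents m' = zs @ ys \<and> F m' = F m"
    if "0 \<notin> Poly_Mapping.keys m" "exponents m = xs @ zs" "mset xs = mset ys" for m xs ys zs
    using that
  proof (induction ys arbitrary: m xs zs)
    case Nil
    then show ?case by auto
  next
    case (Cons a ys)
    then have "a \<in> set xs" by (metis list.set_intros(1) set_mset_mset)
    then obtain us vs where xs: "xs = us @ a # vs" by (meson split_list)
    obtain m' where m': "0 \<notin> Poly_Mapping.keys m'" "exponents m' = (us @ vs) @ zs @ [a]" "F m' = F m"
      using to_end[of m us a "vs @ zs"] Cons.prems xs by auto
    have "mset (us @ vs) = mset ys" using Cons.prems(3) xs by simp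
    from Cons.IH[OF m'(1,2) this] m'(3) show ?case by auto
  qed
  have perm: "F m = F m'"
    if m: "0 \<notin> Poly_Mapping.keys m" "0 \<notin> Poly_Mapping.keys m'" "mset (exponents m) = mset (exponents m')" for m m'
  proof -
    obtain m'' where "0 \<notin> Poly_Mapping.keys m''" "exponents m'' = exponents m'" "F m'' = F m"
      using rearrange[OF m(1) _ m(3), of "[]"] by auto
    then show ?thesis using quasi[OF _ m(2), of m''] by simp
  qed
  show ?thesis
    unfolding symmetric_series_def permute_variables_def
  proof (intro allI impI ext)
    fix \<pi> :: "nat \<Rightarrow> nat" and m :: monomial assume \<pi>: "\<pi> permutes {1..}"
    let ?m = "Poly_Mapping.map_key \<pi> m"
    have inj: "inj \<pi>" using \<pi> by (rule permutes_inj)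
    have look: "Poly_Mapping.lookup ?m c = Poly_Mapping.lookup m (\<pi> c)" for c
      by (rule lookup_map_key_permutes[OF \<pi>])
    have "\<pi> 0 = 0" using \<pi> by (simp add: permutes_def)
    then have zero_iff: "0 \<in> Poly_Mapping.keys ?m \<longleftrightarrow> 0 \<in> Poly_Mapping.keys m" by (simp add: in_keys_iff look)
    have keys: "Poly_Mapping.keys m = \<pi> ` Poly_Mapping.keys ?m"
    proof (intro set_eqI iffI)
      fix c assume "c \<in> Poly_Mapping.keys m"
      moreover obtain b where "c = \<pi> b" using permutes_surj[OF \<pi>] by (metis surjD)
      ultimately show "c \<in> \<pi> ` Poly_Mapping.keys ?m" by (auto simp: in_keys_iff look)
    qed (auto simp: in_keys_iff look)
    have mset_exps: "mset (exponents l) = image_mset (Poly_Mapping.lookup l) (mset_set (Poly_Mapping.keys l))" for l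
      unfolding exponents_def mset_map
      by (metis distinct_sorted_list_of_set finite_keys mset_set_set set_sorted_list_of_set)
    have "mset_set (Poly_Mapping.keys m) = image_mset \<pi> (mset_set (Poly_Mapping.keys ?m))"
      using inj unfolding keys by (intro image_mset_mset_set[symmetric]) (auto intro: inj_on_subset)
    then have "mset (exponents ?m) = mset (exponents m)"
      unfolding mset_exps by (simp add: image_mset.compositionality comp_def look[abs_def])
    then show "F ?m = F m"
      using perm[of ?m m] zero[of m] zero[of ?m] zero_iff by metis
  qed
qed

section \<open>Moving a variable past all others\<close>

text \<open>
  Specialising \<open>q\<close> to \<open>1\<close> turns \<open>\<Sum>\<^sub>\<kappa> q\<^bsup>asc \<kappa>\<^esup>\<close> into the number of proper colorings, and with at least
  as many colors as vertices the coloring of each vertex by its own label is proper. The injection \<open>h\<close>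
  stands for the embedding of \<open>\<int>[q]\<close> into a larger ring.
\<close>
lemma color_sum_one_neq_0:
  fixes h :: "int poly \<Rightarrow> 'a :: comm_ring_1"
  assumes fin: "finite V" "V \<subseteq> {1..N}" and E: "\<And>e. e \<in> E \<Longrightarrow> card e = 2 \<and> e \<subseteq> V"
    and h: "h 0 = 0" "h 1 = 1" "\<And>a b. h (a + b) = h a + h b" "\<And>a b. h (a * b) = h a * h b" "\<And>a. h a = 0 \<Longrightarrow> a = 0"
  shows "color_sum V E N (h [:0, 1:]) (\<lambda>_. 1) \<noteq> 0"
proof
  assume "color_sum V E N (h [:0, 1:]) (\<lambda>_. 1) = 0"
  then have "h (color_sum V E N [:0, 1:] (\<lambda>_. 1)) = 0"
    using color_sum_hom[of h V E N "[:0, 1:]" "\<lambda>_. 1"] h by simp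
  then have "color_sum V E N [:0, 1 :: int:] (\<lambda>_. 1) = 0" by (rule h(5))
  then have "poly (color_sum V E N [:0, 1 :: int:] (\<lambda>_. 1)) 1 = 0" by simp
  then have "color_sum V E N (1 :: int) (\<lambda>_. 1) = 0"
    using color_sum_hom[of "\<lambda>p. poly p 1" V E N "[:0, 1 :: int:]" "\<lambda>_. 1"] by simp
  then have "colorings_upto V E N = {}"
    by (simp add: color_sum_def finite_colorings_upto[OF fin(1)])
  moreover have "restrict (\<lambda>v. v) V \<in> colorings_upto V E N"
    unfolding colorings_upto_def
  proof (intro CollectI conjI allI impI)
    show "restrict (\<lambda>v. v) V \<in> V \<rightarrow>\<^sub>E {1..N}" using fin by auto
    fix u v assume "{u, v} \<in> E"
    then have "card {u, v} = 2" "{u, v} \<subseteq> V" using E by auto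
    then show "restrict (\<lambda>v. v) V u \<noteq> restrict (\<lambda>v. v) V v" by auto
  qed
  ultimately show False by simp
qed

text \<open>
  Each product of the terms \<open>t + z (\<kappa> v)\<close> over the vertices is monic of degree \<open>card V\<close>.
\<close>
lemma color_sum_shift:
  fixes q :: "'a :: idom"
  assumes "finite V" "color_sum V E N q (\<lambda>_. 1) \<noteq> 0"
  shows "degree (color_sum V E N [:q:] (\<lambda>i. [:z i, 1:])) = card V"
    and "lead_coeff (color_sum V E N [:q:] (\<lambda>i. [:z i, 1:])) = color_sum V E N q (\<lambda>_. 1)"
proof -
  let ?P = "color_sum V E N [:q:] (\<lambda>i. [:z i, 1:])"
  define g where "g \<kappa> = (\<Prod>v\<in>V. [:z (\<kappa> v), 1:])" for \<kappa> :: "nat \<Rightarrow> nat"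
  have P: "?P = (\<Sum>\<kappa> \<in> colorings_upto V E N. smult (q ^ asc E \<kappa>) (g \<kappa>))"
    by (simp add: color_sum_def g_def poly_const_pow)
  have deg: "degree (g \<kappa>) = card V" for \<kappa>
    unfolding g_def by (subst degree_prod_eq_sum_degree) auto
  have lead: "lead_coeff (g \<kappa>) = 1" for \<kappa>
    unfolding g_def by (simp add: lead_coeff_prod)
  have coeff: "poly.coeff ?P (card V) = color_sum V E N q (\<lambda>_. 1)"
    unfolding P using lead by (simp add: coeff_sum color_sum_def deg)
  have "degree ?P \<le> card V"
    unfolding P by (rule degree_sum_le) (auto simp: assms finite_colorings_upto deg intro: order_trans[OF degree_smult_le])
  moreover have "card V \<le> degree ?P" using coeff assms(2) by (intro le_degree) simp
  ultimately show "degree ?P = card V" by simp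
  then show "lead_coeff ?P = color_sum V E N q (\<lambda>_. 1)" using coeff by simp
qed

text \<open>
  If \<open>k\<close> and \<open>l\<close> are distinct indices beyond all variables of \<open>m\<close>, then applying \<open>(i l)\<close> to \<open>m\<close> with \<open>x\<^sub>i\<close>
  replaced by \<open>x\<^sub>k\<close> has no effect, while applying \<open>(i k)\<close> gives back \<open>m\<close>. So it is enough that these two
  transpositions act in the same way on the series for one pair of such indices; the pigeonhole
  principle provides the pair, because all images of the series under transpositions \<open>(i k)\<close> divide
  the symmetric series of \<open>G\<close>.
\<close>
lemma cqf_key_raisable:
  assumes E: "\<And>e. e \<in> E \<Longrightarrow> e \<subseteq> {1..d} \<and> card e = 2" and G: "\<And>e. e \<in> G \<Longrightarrow> e \<subseteq> {1..n} \<and> card e = 2"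
    and sym: "symmetric_series (cqf n G)"
    and dvd: "\<And>N (q :: (monomial \<Rightarrow>\<^sub>0 int poly) fract poly) y. color_sum {1..d} E N q y dvd color_sum {1..n} G N q y"
    and m: "0 \<notin> Poly_Mapping.keys m" "i \<in> Poly_Mapping.keys m"
  shows "\<exists>k. (\<forall>j \<in> Poly_Mapping.keys m. j < k) \<and> cqf d E (Poly_Mapping.map_key (transpose i k) m) = cqf d E m"
proof -
  \<comment> \<open>\<open>K\<close> consists of \<open>2 ^ n + 1\<close> indices beyond all variables of \<open>m\<close>. Adding \<open>d + n\<close> to the bound
    provides enough colors for the leading coefficients not to vanish.\<close>
  define B where "B = Max (Poly_Mapping.keys m) + d + n"
  define N where "N = B + 2 ^ n + 1"
  define K where "K = {B<..N}"
  have B: "j \<le> B" if "j \<in> Poly_Mapping.keys m" for j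
    using Max_ge[OF finite_keys that] by (simp add: B_def)
  have i: "1 \<le> i" "i \<le> B" using m B by (auto simp: Suc_le_eq intro: Nat.gr0I)
  have K: "B < k" "k \<le> N" "k \<noteq> i" if "k \<in> K" for k using that i by (auto simp: K_def)
  have BN: "B \<le> N" "d \<le> N" "n \<le> N" by (simp_all add: N_def B_def)
  define x :: "nat \<Rightarrow> monomial \<Rightarrow>\<^sub>0 int poly" where "x j = Poly_Mapping.single (Poly_Mapping.single j 1) 1" for j
  define q :: "monomial \<Rightarrow>\<^sub>0 int poly" where "q = Poly_Mapping.single 0 [:0, 1:]"
  define y where "y j = [:to_fract (x j), 1:]" for j
  define P where "P k = color_sum {1..d} E N [:to_fract q:] (\<lambda>j. y (transpose i k j))" for k
  define S where "S = color_sum {1..n} G N [:to_fract q:] y"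
  define c where "c = color_sum {1..d} E N (to_fract q) (\<lambda>_. 1)"
  have perm: "transpose i k permutes {1..N}" if "k \<in> K" for k
    using i K[OF that] BN by (intro permutes_swap_id) auto
  have single_mult: "Poly_Mapping.single 0 (a * b) = Poly_Mapping.single (0 :: monomial) a * Poly_Mapping.single 0 b" for a b :: "int poly"
    by (simp add: mult_single)
  have nz: "color_sum {1..r} H N (to_fract q) (\<lambda>_. 1) \<noteq> 0"
    if "r \<le> N" "\<And>e. e \<in> H \<Longrightarrow> e \<subseteq> {1..r} \<and> card e = 2" for r H
    unfolding q_def
    by (rule color_sum_one_neq_0[where h = "\<lambda>a. to_fract (Poly_Mapping.single 0 a)"])
       (use that in \<open>auto simp: single_add single_mult dest: arg_cong[of _ _ "\<lambda>p. Poly_Mapping.lookup p 0"]\<close>)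
  have S: "degree S = n" "lead_coeff S = color_sum {1..n} G N (to_fract q) (\<lambda>_. 1)"
    using color_sum_shift[of "{1..n}" G N "to_fract q" "\<lambda>j. to_fract (x j)"] nz[OF BN(3) G]
    unfolding S_def y_def[abs_def] by auto
  then have "S \<noteq> 0" using nz[OF BN(3) G] by force
  have P: "P k dvd S \<and> lead_coeff (P k) = c" if "k \<in> K" for k
  proof
    have "S = color_sum {1..n} G N [:to_fract q:] (\<lambda>j. y (transpose i k j))"
      unfolding S_def by (rule color_sum_symmetric[OF sym perm[OF that], symmetric])
    then show "P k dvd S" using dvd by (simp add: P_def)
    show "lead_coeff (P k) = c"
      unfolding P_def y_def c_def by (rule color_sum_shift(2)) (use nz[OF BN(2) E] in auto)
  qed
  have "card (P ` K) \<le> card {g. g dvd S \<and> lead_coeff g = c}"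
    by (rule card_mono) (use P card_divisors_with_lead_coeff[OF \<open>S \<noteq> 0\<close>, of c] in \<open>auto simp del: One_nat_def\<close>)
  also have "\<dots> \<le> 2 ^ n" using card_divisors_with_lead_coeff[OF \<open>S \<noteq> 0\<close>, of c] unfolding S(1) by simp
  also have "\<dots> < card K" by (simp add: K_def N_def)
  finally have "\<not> inj_on P K" by (rule pigeonhole)
  then obtain k l where kl: "k \<in> K" "l \<in> K" "k \<noteq> l" "P k = P l" by (auto simp: inj_on_def)
  \<comment> \<open>Undo the shift by \<open>t = 0\<close>, to get from the polynomials in \<open>t\<close> back to those in the \<open>x\<^sub>j\<close>.\<close>
  define C where "C k = color_sum {1..d} E N q (\<lambda>j. x (transpose i k j))" for k
  have "poly (P k) 0 = to_fract (C k)" for k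
  proof -
    have "poly (P k) 0 = color_sum {1..d} E N (to_fract q) (\<lambda>j. to_fract (x (transpose i k j)))"
      using color_sum_hom[of "\<lambda>p. poly p 0" "{1..d}" E N "[:to_fract q:]" "\<lambda>j. y (transpose i k j)"]
      by (simp add: P_def y_def)
    also have "\<dots> = to_fract (C k)"
      unfolding C_def by (rule color_sum_hom[symmetric]) auto
    finally show ?thesis .
  qed
  then have "C k = C l" using kl(4) by (metis to_fract_eq_iff)
  let ?\<mu> = "Poly_Mapping.map_key (transpose i k) m"
  have look: "Poly_Mapping.lookup (Poly_Mapping.map_key (transpose i r) m') j = Poly_Mapping.lookup m' (transpose i r j)" for r m' j
    by (simp add: map_key.rep_eq)
  have "Poly_Mapping.keys ?\<mu> \<subseteq> {1..N}"
  proof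
    fix j assume "j \<in> Poly_Mapping.keys ?\<mu>"
    then have t: "transpose i k j \<in> Poly_Mapping.keys m" by (simp add: in_keys_iff look)
    then have "transpose i k j \<noteq> 0" using m(1) by metis
    moreover have "transpose i k j \<le> N" using B[OF t] BN(1) by simp
    ultimately have "transpose i k j \<in> {1..N}" by simp
    then show "j \<in> {1..N}" using permutes_in_image[OF perm[OF kl(1)]] by blast
  qed
  then have C: "Poly_Mapping.lookup (C r) ?\<mu> = cqf d E (Poly_Mapping.map_key (transpose i r) ?\<mu>)" if "r \<in> K" for r
    unfolding C_def q_def x_def by (rule lookup_color_sum_variables[OF perm[OF that]])
  have "Poly_Mapping.map_key (transpose i k) ?\<mu> = m"
    by (rule poly_mapping_eqI) (simp add: look)
  moreover have "Poly_Mapping.map_key (transpose i l) ?\<mu> = ?\<mu>"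
  proof (rule poly_mapping_eqI)
    fix j
    have "Poly_Mapping.lookup m k = 0" "Poly_Mapping.lookup m l = 0"
      using B K(1)[OF kl(1)] K(1)[OF kl(2)] by (meson in_keys_iff not_less)+
    then show "Poly_Mapping.lookup (Poly_Mapping.map_key (transpose i l) ?\<mu>) j = Poly_Mapping.lookup ?\<mu> j"
      using kl K(3) unfolding look by (auto simp: transpose_def)
  qed
  ultimately have "cqf d E ?\<mu> = cqf d E m" using C[OF kl(1)] C[OF kl(2)] \<open>C k = C l\<close> by simp
  moreover have "\<forall>j \<in> Poly_Mapping.keys m. j < k" using B K(1)[OF kl(1)] by fastforce
  ultimately show ?thesis by blast
qed

section \<open>Components of a graph with symmetric chromatic quasisymmetric function\<close>

theorem corollary1p5:
  fixes n :: nat and E :: "nat set set"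
  assumes "labeled_graph n E"
    and "card (components n E) \<ge> 2"
    and "symmetric_series (cqf n E)"
  shows "\<forall>C \<in> components n E. symmetric_series (cqf (card C) (component_edges E C))"
proof
  fix C assume C: "C \<in> components n E"
  then have "C \<subseteq> {1..n}" by (auto simp: components_def elim: quotientE)
  then have fin: "finite C" by (rule finite_subset) simp
  have G: "e \<subseteq> {1..n} \<and> card e = 2" if "e \<in> E" for e using assms(1) that by (simp add: labeled_graph_def)
  have comp: "e \<subseteq> {1..card C} \<and> card e = 2" if e: "e \<in> component_edges E C" for e
  proof -
    obtain f where f: "f \<in> E" "f \<subseteq> C" "e = relabel C ` f" using e by (auto simp: component_edges_def)
    have bij: "bij_betw (relabel C) C {1..card C}" by (rule relabel_order_isomorphism[OF fin])
    then have "card e = card f" using f by (metis bij_betw_def card_image inj_on_subset)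
    moreover have "e \<subseteq> {1..card C}" using bij f(2,3) by (metis bij_betw_def image_mono)
    ultimately show ?thesis using f(1) G by simp
  qed
  show "symmetric_series (cqf (card C) (component_edges E C))"
  proof (rule symmetric_series_if_key_raisable)
    fix m m' assume "0 \<notin> Poly_Mapping.keys m" "0 \<notin> Poly_Mapping.keys m'" "exponents m = exponents m'"
    then show "cqf (card C) (component_edges E C) m = cqf (card C) (component_edges E C) m'"
      using comp by (intro cqf_quasisymmetric) auto
  next
    fix m :: monomial and i assume "0 \<notin> Poly_Mapping.keys m" "i \<in> Poly_Mapping.keys m"
    then show "\<exists>k. (\<forall>j \<in> Poly_Mapping.keys m. j < k) \<and> cqf (card C) (component_edges E C) (Poly_Mapping.map_key (transpose i k) m)
        = cqf (card C) (component_edges E C) m"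
      by (intro cqf_key_raisable[OF comp G assms(3) color_sum_component_dvd[OF assms(1) C]]) auto
  qed (rule cqf_zero_key)
qed

end
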